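(* Let $n,m\ge1$, let $K$ be a field of characteristic zero, and let $M=\bigoplus_{(u,v)\in\mathbb{Z}^2}M_{(u,v)}$ be a bigraded holonomic generalized Eulerian $A_{n,m}(K)$-module. Then there exist polynomials $P^a_M(X,Y)\in\mathbb{Q}[X,Y]$, $a=1,2,3,4$, such that: (i) $P^1_M(u,v)=\dim_K M_{(u,v)}$ for all $u,v\gg0$, if $\dim_K M_{(u_1,v_1)}$ is finite for some $(u_1,v_1)\in\mathbb{Z}^2$ with $u_1\ge0$, $v_1\ge0$; (ii) $P^2_M(u,v)=\dim_K M_{(u,v)}$ for all $u\ll0$, $v\gg0$, if $\dim_K M_{(u_1,v_1)}$ is finite for some $(u_1,v_1)\in\mathbb{Z}^2$ with $u_1\le-n$, $v_1\ge0$; (iii) $P^3_M(u,v)=\dim_K M_{(u,v)}$ for all $u,v\ll0$, if $\dim_K M_{(u_1,v_1)}$ is finite for some $(u_1,v_1)\in\mathbb{Z}^2$ with $u_1\le-n$, $v_1\le-m$; (iv) $P^4_M(u,v)=\dim_K M_{(u,v)}$ for all $u\gg0$, $v\ll0$, if $\dim_K M_{(u_1,v_1)}$ is finite for some $(u_1,v_1)\in\mathbb{Z}^2$ with $u_1\ge0$, $v_1\le-m$.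
   Context: $R=K[X_1,\dots,X_n,Y_1,\dots,Y_m]$ and $A_{n,m}(K)=R\langle \partial_1,\dots,\partial_n,\delta_1,\dots,\delta_m\rangle$ is the Weyl algebra over $K$ in $n+m$ variables, with $\partial_i=\partial/\partial X_i$, $\delta_j=\partial/\partial Y_j$, $\mathbb{Z}^2$-graded by $\operatorname{bideg} X_i=(1,0)$, $\operatorname{bideg} Y_j=(0,1)$, $\operatorname{bideg}\partial_i=(-1,0)$, $\operatorname{bideg}\delta_j=(0,-1)$ and $K$ in bidegree $(0,0)$. A bigraded $A_{n,m}(K)$-module is holonomic if, as a left module over the Weyl algebra in $n+m$ variables, it is zero or finitely generated of (Bernstein) dimension $n+m$. Put $\mathcal{E}^X_n=\sum_{i=1}^n X_i\partial_i$ and $\mathcal{E}^Y_m=\sum_{j=1}^m Y_j\delta_j$. A bigraded $A_{n,m}(K)$-module $E$ is generalized Eulerian if for each bihomogeneous $e\in E$ with $\operatorname{bideg} e=(u,v)$ there is an integer $a>0$ with $(\mathcal{E}^X_n-u)^a e=0$ and $(\mathcal{E}^Y_m-v)^a e=0$. *)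

theory Defs
  imports
    Complex_Main
    "HOL-Library.Cardinality"
    "HOL-Library.Poly_Mapping"
    "HOL-Library.Product_Plus"
    "HOL-Computational_Algebra.Polynomial"
begin

section \<open>The Weyl algebra in variables indexed by a type\<close>

type_synonym ('k, 'i) mpoly = "('i \<Rightarrow>\<^sub>0 nat) \<Rightarrow>\<^sub>0 'k"

definition mconst :: "'k::field_char_0 \<Rightarrow> ('k, 'i) mpoly" where
  "mconst c = Poly_Mapping.single 0 c"

definition mvar :: "'i \<Rightarrow> ('k::field_char_0, 'i) mpoly" where
  "mvar i = Poly_Mapping.single (Poly_Mapping.single i 1) 1"

text \<open>The exponent subtraction is truncated, which is harmless: if \<open>i\<close> does not occur in the
  monomial \<open>t\<close>, the coefficient below vanishes.\<close>

definition partial :: "'i \<Rightarrow> ('k::field_char_0, 'i) mpoly \<Rightarrow> ('k, 'i) mpoly" where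
  "partial i p = (\<Sum>t\<in>Poly_Mapping.keys p.
     Poly_Mapping.single (t - Poly_Mapping.single i 1)
       (of_nat (Poly_Mapping.lookup t i) * Poly_Mapping.lookup p t))"

text \<open>In characteristic zero the Weyl algebra over \<open>K\<close> is the subalgebra of the endomorphism
  algebra of the polynomial ring \<open>R\<close> generated by the multiplications with elements of \<open>R\<close>
  and the partial derivatives; its product is composition.\<close>

inductive_set weyl_ops :: "(('k::field_char_0, 'i) mpoly \<Rightarrow> ('k, 'i) mpoly) set" where
  mult: "(\<lambda>q. p * q) \<in> weyl_ops"
| partial: "partial i \<in> weyl_ops"
| add: "P \<in> weyl_ops \<Longrightarrow> Q \<in> weyl_ops \<Longrightarrow> (\<lambda>q. P q + Q q) \<in> weyl_ops"
| comp: "P \<in> weyl_ops \<Longrightarrow> Q \<in> weyl_ops \<Longrightarrow> (\<lambda>q. P (Q q)) \<in> weyl_ops"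

lemma partial_superset:
  assumes "finite S" "Poly_Mapping.keys p \<subseteq> S"
  shows "partial i p = (\<Sum>t\<in>S. Poly_Mapping.single (t - Poly_Mapping.single i 1)
       (of_nat (Poly_Mapping.lookup t i) * Poly_Mapping.lookup p t))"
  unfolding partial_def
  by (rule sum.mono_neutral_left) (use assms in \<open>auto simp: in_keys_iff\<close>)

lemma partial_add: "partial i (p + q) = partial i p + partial i q"
proof -
  let ?S = "Poly_Mapping.keys p \<union> Poly_Mapping.keys q"
  have "Poly_Mapping.keys (p + q) \<subseteq> ?S" by (rule Poly_Mapping.keys_add)
  then show ?thesis
    by (simp add: partial_superset[of ?S] sum.distrib[symmetric] single_add[symmetric]
        lookup_add distrib_left)
qed

lemma weyl_ops_add: "P \<in> weyl_ops \<Longrightarrow> P (p + q) = P p + P q"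
  by (induction arbitrary: p q rule: weyl_ops.induct)
    (simp_all add: partial_add distrib_left add_ac)

lemma weyl_ops_zero: "P \<in> weyl_ops \<Longrightarrow> P 0 = 0"
  using weyl_ops_add[of P 0 0] by simp

lemma weyl_ops_const_zero: "(\<lambda>q. 0) \<in> weyl_ops"
  and weyl_ops_id: "(\<lambda>q. q) \<in> weyl_ops"
  and weyl_ops_uminus: "P \<in> weyl_ops \<Longrightarrow> (\<lambda>q. - P q) \<in> weyl_ops"
proof -
  have "(\<lambda>q. 0 * q) \<in> weyl_ops" "(\<lambda>q. 1 * q) \<in> weyl_ops"
    by (rule weyl_ops.mult)+
  then show "(\<lambda>q. 0) \<in> weyl_ops" "(\<lambda>q. q) \<in> weyl_ops"
    by (simp_all only: mult_zero_left mult_1_left)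
  assume "P \<in> weyl_ops"
  from weyl_ops.comp[OF weyl_ops.mult[of "- 1"] this] show "(\<lambda>q. - P q) \<in> weyl_ops"
    by simp
qed

typedef (overloaded) ('k, 'i) weyl =
  "weyl_ops :: (('k::field_char_0, 'i) mpoly \<Rightarrow> ('k, 'i) mpoly) set"
  by (blast intro: weyl_ops.mult)

lifting_forget poly_mapping.lifting
setup_lifting type_definition_weyl

lift_definition wmult :: "('k::field_char_0, 'i) mpoly \<Rightarrow> ('k, 'i) weyl" is "\<lambda>p q. p * q"
  by (rule weyl_ops.mult)

lift_definition wpartial :: "'i \<Rightarrow> ('k::field_char_0, 'i) weyl" is partial
  by (rule weyl_ops.partial)

instantiation weyl :: (field_char_0, type) ring_1
begin

lift_definition zero_weyl :: "('a, 'b) weyl" is "\<lambda>q. 0"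
  by (rule weyl_ops_const_zero)

lift_definition one_weyl :: "('a, 'b) weyl" is "\<lambda>q. q"
  by (rule weyl_ops_id)

lift_definition plus_weyl :: "('a, 'b) weyl \<Rightarrow> ('a, 'b) weyl \<Rightarrow> ('a, 'b) weyl"
  is "\<lambda>P Q q. P q + Q q"
  by (rule weyl_ops.add)

lift_definition uminus_weyl :: "('a, 'b) weyl \<Rightarrow> ('a, 'b) weyl" is "\<lambda>P q. - P q"
  by (rule weyl_ops_uminus)

lift_definition minus_weyl :: "('a, 'b) weyl \<Rightarrow> ('a, 'b) weyl \<Rightarrow> ('a, 'b) weyl"
  is "\<lambda>P Q q. P q - Q q"
  using weyl_ops.add[OF _ weyl_ops_uminus] by simp

lift_definition times_weyl :: "('a, 'b) weyl \<Rightarrow> ('a, 'b) weyl \<Rightarrow> ('a, 'b) weyl"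
  is "\<lambda>P Q q. P (Q q)"
  by (rule weyl_ops.comp)

instance
proof
  show "(0::('a, 'b) weyl) \<noteq> 1"
    by transfer (auto dest: fun_cong[where x = 1])
qed (transfer; auto simp: algebra_simps weyl_ops_add)+

end

unbundle poly_mapping.lifting


abbreviation wconst :: "'k::field_char_0 \<Rightarrow> ('k, 'i) weyl" where
  "wconst c \<equiv> wmult (mconst c)"

abbreviation wvar :: "'i \<Rightarrow> ('k::field_char_0, 'i) weyl" where
  "wvar i \<equiv> wmult (mvar i)"

text \<open>Normally ordered monomials. Variables commute with each other, and so do derivatives, so
  only the multiplicities in the two lists matter; these are the exponents of the monomial.\<close>

definition wmonom :: "'i list \<Rightarrow> 'i list \<Rightarrow> ('k::field_char_0, 'i) weyl" where
  "wmonom is js = prod_list (map wvar is) * prod_list (map wpartial js)"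


section \<open>Left modules\<close>

locale left_module =
  fixes act :: "'r::ring_1 \<Rightarrow> 'v::ab_group_add \<Rightarrow> 'v"
  assumes act_add_right: "act r (x + y) = act r x + act r y"
    and act_add_left: "act (r + s) x = act r x + act s x"
    and act_mult: "act (r * s) x = act r (act s x)"
    and act_one: "act 1 x = x"

definition finitely_generated_module :: "('r::ring_1 \<Rightarrow> 'v::ab_group_add \<Rightarrow> 'v) \<Rightarrow> bool" where
  "finitely_generated_module act \<longleftrightarrow>
     (\<exists>S. finite S \<and> (\<forall>v. \<exists>a. v = (\<Sum>s\<in>S. act (a s) s)))"

text \<open>The structure of \<open>K\<close>-vector space underlying a module over the Weyl algebra. With the
  product of the Weyl algebra as action this also covers the Weyl algebra itself.\<close>

definition kscale :: "(('k::field_char_0, 'i) weyl \<Rightarrow> 'v::ab_group_add \<Rightarrow> 'v) \<Rightarrow> 'k \<Rightarrow> 'v \<Rightarrow> 'v" where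
  "kscale act c v = act (wconst c) v"

abbreviation kspan :: "(('k::field_char_0, 'i) weyl \<Rightarrow> 'v::ab_group_add \<Rightarrow> 'v) \<Rightarrow> 'v set \<Rightarrow> 'v set" where
  "kspan act \<equiv> module.span (kscale act)"

abbreviation ksubspace :: "(('k::field_char_0, 'i) weyl \<Rightarrow> 'v::ab_group_add \<Rightarrow> 'v) \<Rightarrow> 'v set \<Rightarrow> bool" where
  "ksubspace act \<equiv> module.subspace (kscale act)"

text \<open>The library dimension is \<open>0\<close> for infinite-dimensional spaces, so it is always used together
  with the predicate \<open>kfinite\<close>.\<close>

abbreviation kdim :: "(('k::field_char_0, 'i) weyl \<Rightarrow> 'v::ab_group_add \<Rightarrow> 'v) \<Rightarrow> 'v set \<Rightarrow> nat" where
  "kdim act \<equiv> vector_space.dim (kscale act)"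

definition kfinite :: "(('k::field_char_0, 'i) weyl \<Rightarrow> 'v::ab_group_add \<Rightarrow> 'v) \<Rightarrow> 'v set \<Rightarrow> bool" where
  "kfinite act V \<longleftrightarrow> (\<exists>B. finite B \<and> V = kspan act B)"


section \<open>Bernstein dimension and holonomic modules\<close>

definition bernstein :: "nat \<Rightarrow> ('k::field_char_0, 'i) weyl set" where
  "bernstein k = kspan (*) {wmonom is js | is js. length is + length js \<le> k}"

definition good_filtration ::
    "(('k::field_char_0, 'i) weyl \<Rightarrow> 'v::ab_group_add \<Rightarrow> 'v) \<Rightarrow> (nat \<Rightarrow> 'v set) \<Rightarrow> bool" where
  "good_filtration act \<Gamma> \<longleftrightarrow>
     (\<forall>j. ksubspace act (\<Gamma> j) \<and> kfinite act (\<Gamma> j)) \<and>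
     (\<forall>j. \<Gamma> j \<subseteq> \<Gamma> (Suc j)) \<and>
     (\<Union>j. \<Gamma> j) = UNIV \<and>
     (\<forall>i j. \<forall>P\<in>bernstein i. \<forall>v\<in>\<Gamma> j. act P v \<in> \<Gamma> (i + j)) \<and>
     (\<exists>j0. \<forall>j\<ge>j0. \<forall>i. \<Gamma> (i + j) = kspan act {act P v | P v. P \<in> bernstein i \<and> v \<in> \<Gamma> j})"

text \<open>The Bernstein dimension of a nonzero finitely generated module is the degree of the Hilbert
  polynomial of a good filtration; it does not depend on the filtration, and is rendered as a
  relation between a module and its dimension.\<close>

definition has_bernstein_dim ::
    "(('k::field_char_0, 'i) weyl \<Rightarrow> 'v::ab_group_add \<Rightarrow> 'v) \<Rightarrow> nat \<Rightarrow> bool" where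
  "has_bernstein_dim act d \<longleftrightarrow>
     (\<exists>\<Gamma> (\<chi> :: rat poly). good_filtration act \<Gamma> \<and>
        (\<exists>t0. \<forall>t\<ge>t0. of_nat (kdim act (\<Gamma> t)) = poly \<chi> (of_nat t)) \<and> degree \<chi> = d)"

definition holonomic :: "(('k::field_char_0, 'i::finite) weyl \<Rightarrow> 'v::ab_group_add \<Rightarrow> 'v) \<Rightarrow> bool" where
  "holonomic act \<longleftrightarrow>
     (\<forall>v::'v. v = 0) \<or>
     (finitely_generated_module act \<and> has_bernstein_dim act CARD('i))"


section \<open>Bigraded and generalized Eulerian modules\<close>

text \<open>The variables are indexed by \<open>'n + 'm\<close>: \<open>Inl i\<close> is the index of \<open>X\<close>-variables and \<open>Inr j\<close> that
  of \<open>Y\<close>-variables, so that \<open>n = CARD('n)\<close> and \<open>m = CARD('m)\<close>.\<close>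

fun var_bideg :: "'n + 'm \<Rightarrow> int \<times> int" where
  "var_bideg (Inl _) = (1, 0)"
| "var_bideg (Inr _) = (0, 1)"

definition weyl_component :: "int \<times> int \<Rightarrow> ('k::field_char_0, 'n + 'm) weyl set" where
  "weyl_component d = kspan (*) {wmonom is js | is js.
     sum_list (map var_bideg is) - sum_list (map var_bideg js) = d}"

definition bigraded ::
    "(('k::field_char_0, 'n + 'm) weyl \<Rightarrow> 'v::ab_group_add \<Rightarrow> 'v) \<Rightarrow> (int \<times> int \<Rightarrow> 'v set) \<Rightarrow> bool" where
  "bigraded act M \<longleftrightarrow>
     (\<forall>d. ksubspace act (M d)) \<and>
     (\<forall>v. \<exists>!f :: int \<times> int \<Rightarrow>\<^sub>0 'v. (\<forall>d. Poly_Mapping.lookup f d \<in> M d) \<and>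
        v = (\<Sum>d\<in>Poly_Mapping.keys f. Poly_Mapping.lookup f d)) \<and>
     (\<forall>d e. \<forall>P\<in>weyl_component d. \<forall>v\<in>M e. act P v \<in> M (d + e))"

definition euler_X :: "('k::field_char_0, 'n::finite + 'm::finite) weyl" where
  "euler_X = (\<Sum>i\<in>UNIV. wvar (Inl i) * wpartial (Inl i))"

definition euler_Y :: "('k::field_char_0, 'n::finite + 'm::finite) weyl" where
  "euler_Y = (\<Sum>j\<in>UNIV. wvar (Inr j) * wpartial (Inr j))"

definition generalized_eulerian ::
    "(('k::field_char_0, 'n::finite + 'm::finite) weyl \<Rightarrow> 'v::ab_group_add \<Rightarrow> 'v) \<Rightarrow>
     (int \<times> int \<Rightarrow> 'v set) \<Rightarrow> bool" where
  "generalized_eulerian act M \<longleftrightarrow>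
     (\<forall>u v. \<forall>e\<in>M (u, v). \<exists>a>0.
        act ((euler_X - of_int u) ^ a) e = 0 \<and> act ((euler_Y - of_int v) ^ a) e = 0)"

definition poly2 :: "rat poly poly \<Rightarrow> int \<Rightarrow> int \<Rightarrow> rat" where
  "poly2 P u v = poly (poly P [:of_int v:]) (of_int u)"

text \<open>That \<open>P\<close> gives the dimension of a component means in particular that it is finite.\<close>

definition dim_given_by ::
    "(('k::field_char_0, 'n + 'm) weyl \<Rightarrow> 'v::ab_group_add \<Rightarrow> 'v) \<Rightarrow> (int \<times> int \<Rightarrow> 'v set) \<Rightarrow>
     rat poly poly \<Rightarrow> int \<Rightarrow> int \<Rightarrow> bool" where
  "dim_given_by act M P u v \<longleftrightarrow>
     kfinite act (M (u, v)) \<and> poly2 P u v = of_nat (kdim act (M (u, v)))"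

end

theory Submission
  imports Defs "HOL-Library.List_Lexorder"
begin

text \<open>On the component of bidegree \<open>(u, v)\<close> the Euler operator \<open>\<Sum> X\<^sub>i \<partial>\<^sub>i\<close> is \<open>u\<close> plus a locally nilpotent
  operator, so it is invertible there unless \<open>u = 0\<close>, and \<open>\<Sum> \<partial>\<^sub>i X\<^sub>i = \<Sum> X\<^sub>i \<partial>\<^sub>i + n\<close> is invertible unless
  \<open>u = - n\<close>. Hence for \<open>u \<noteq> 0\<close> the component is the sum of the images under the \<open>X\<^sub>i\<close> of its neighbour
  at \<open>u - 1\<close>, and for \<open>u \<noteq> - n\<close> that of the images under the \<open>\<partial>\<^sub>i\<close> of its neighbour at \<open>u + 1\<close>; likewise
  for \<open>v\<close>. Within a quadrant finiteness of one component therefore spreads to the corner, and the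
  quadrant is generated from the corner by commuting operators (\<open>X\<^sub>i\<close> or \<open>\<partial>\<^sub>i\<close>, \<open>Y\<^sub>j\<close> or \<open>\<delta>\<^sub>j\<close>). So the
  dimensions are values of the Hilbert function of a finitely generated bigraded module over a
  polynomial ring.\<close>

section \<open>Eventually polynomial functions\<close>

text \<open>Telescoping \<open>(i + 1) ^ Suc k - i ^ Suc k\<close> and expanding by the binomial
  theorem expresses the \<open>k\<close>-th power sum through those of lower exponent; solving for
  it gives \<open>r\<close>.\<close>

lemma sum_power_eq_poly: "\<exists>q :: rat poly. \<forall>n::nat. (\<Sum>i\<le>n. of_nat i ^ k) = poly q (of_nat n)"
proof (induction k rule: less_induct)
  case (less k)
  then obtain q :: "nat \<Rightarrow> rat poly"
    where q: "\<And>j n. j < k \<Longrightarrow> (\<Sum>i\<le>n. of_nat i ^ j) = poly (q j) (of_nat n)"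
    by metis
  define r where "r = smult (1 / of_nat (Suc k))
    ([:1, 1:] ^ Suc k - (\<Sum>j<k. smult (of_nat (Suc k choose j)) (q j)))"
  have "(\<Sum>i\<le>n. of_nat i ^ k) = poly r (of_nat n)" for n
  proof -
    have tele: "(\<Sum>i\<le>n. of_nat (Suc i) ^ Suc k - of_nat i ^ Suc k) = (of_nat (Suc n) ^ Suc k :: rat)"
      by (induction n) auto
    have "of_nat (Suc i) ^ Suc k - of_nat i ^ Suc k
        = of_nat (Suc k) * of_nat i ^ k + (\<Sum>j<k. of_nat (Suc k choose j) * (of_nat i ^ j :: rat))" for i
    proof -
      have "(of_nat (Suc i) ^ Suc k :: rat) = (of_nat i + 1) ^ Suc k"
        by (simp add: add.commute)
      also have "\<dots> = (\<Sum>j\<le>Suc k. of_nat (Suc k choose j) * of_nat i ^ j)"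
        by (subst binomial_ring) simp
      also have "\<dots> = (\<Sum>j<k. of_nat (Suc k choose j) * of_nat i ^ j)
          + of_nat (Suc k choose k) * of_nat i ^ k + of_nat i ^ Suc k"
        by (simp add: lessThan_Suc_atMost[symmetric] del: binomial_Suc_Suc power_Suc)
      also have "Suc k choose k = Suc k"
        using binomial_symmetric[of k "Suc k"] by simp
      finally show ?thesis by simp
    qed
    then have "(of_nat (Suc n) ^ Suc k :: rat)
        = of_nat (Suc k) * (\<Sum>i\<le>n. of_nat i ^ k) + (\<Sum>j<k. of_nat (Suc k choose j) * poly (q j) (of_nat n))"
      unfolding tele[symmetric]
      by (simp add: sum.distrib sum_distrib_left q[symmetric] del: binomial_Suc_Suc power_Suc of_nat_Suc)
        (rule sum.swap)
    then show ?thesis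
      by (simp add: r_def poly_sum field_simps del: binomial_Suc_Suc)
  qed
  then show ?case by blast
qed

lemma sum_poly_eq_poly: "\<exists>q :: rat poly. \<forall>n::nat. (\<Sum>i\<le>n. poly p (of_nat i)) = poly q (of_nat n)"
proof -
  obtain s :: "nat \<Rightarrow> rat poly" where s: "\<And>k n. (\<Sum>i\<le>n. of_nat i ^ k) = poly (s k) (of_nat n)"
    using sum_power_eq_poly by metis
  have "(\<Sum>i\<le>n. poly p (of_nat i)) = poly (\<Sum>k\<le>degree p. smult (coeff p k) (s k)) (of_nat n)" for n
    by (simp add: poly_altdef[of p] poly_sum sum_distrib_left s[symmetric]) (rule sum.swap)
  then show ?thesis by blast
qed

definition eventually_poly :: "(nat \<Rightarrow> rat) \<Rightarrow> bool" where
  "eventually_poly f \<longleftrightarrow> (\<exists>p N. \<forall>n\<ge>N. f n = poly p (of_nat n))"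

lemma eventually_poly_const: "eventually_poly (\<lambda>_. c)"
  unfolding eventually_poly_def by (rule exI[of _ "[:c:]"]) simp

lemma eventually_poly_cmult: "eventually_poly f \<Longrightarrow> eventually_poly (\<lambda>n. c * f n)"
  unfolding eventually_poly_def by (metis poly_smult)

lemma eventually_poly_delta: "eventually_poly (\<lambda>n. if n = m then 1 else 0)"
  unfolding eventually_poly_def by (rule exI[of _ "0::rat poly"], rule exI[of _ "Suc m"]) simp

text \<open>The case distinction guards against truncated subtraction.\<close>

lemma eventually_poly_shift:
  assumes "eventually_poly f"
  shows "eventually_poly (\<lambda>n. if t \<le> n then f (n - t) else 0)"
proof -
  obtain p N where p: "\<forall>n\<ge>N. f n = poly p (of_nat n)"
    using assms unfolding eventually_poly_def by blast
  show ?thesis unfolding eventually_poly_def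
    by (rule exI[of _ "pcompose p [:- of_nat t, 1:]"], rule exI[of _ "N + t"])
      (use p in \<open>auto simp: poly_pcompose of_nat_diff\<close>)
qed

lemma eventually_poly_partial_sum:
  assumes "eventually_poly f"
  shows "eventually_poly (\<lambda>n. \<Sum>i\<le>n. f i)"
proof -
  obtain p N where p: "\<And>n. n \<ge> N \<Longrightarrow> f n = poly p (of_nat n)"
    using assms unfolding eventually_poly_def by blast
  obtain q where q: "\<And>n::nat. (\<Sum>i\<le>n. poly p (of_nat i)) = poly q (of_nat n)"
    using sum_poly_eq_poly by blast
  \<comment> \<open>The finitely many deviations of \<open>f\<close> from \<open>p\<close> add up to
    a constant once \<open>n\<close> is large.\<close>
  have "(\<Sum>i\<le>n. f i) = poly (q + [:\<Sum>i<N. f i - poly p (of_nat i):]) (of_nat n)" if "n \<ge> N" for n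
  proof -
    have "(\<Sum>i\<le>n. f i - poly p (of_nat i)) = (\<Sum>i<N. f i - poly p (of_nat i))"
      by (rule sum.mono_neutral_right) (use that p in auto)
    then show ?thesis
      by (simp add: sum_subtractf q)
  qed
  then show ?thesis unfolding eventually_poly_def by blast
qed

text \<open>Finite sums of products, rather than functions agreeing with a polynomial for large
  \<open>a\<close> and \<open>b\<close>: partial sums in \<open>a\<close> also run over small
  \<open>a\<close>, where the behaviour in \<open>b\<close> must still be eventually
  polynomial.\<close>

inductive eventually_poly2 :: "(nat \<Rightarrow> nat \<Rightarrow> rat) \<Rightarrow> bool" where
  prod: "eventually_poly f \<Longrightarrow> eventually_poly g \<Longrightarrow> eventually_poly2 (\<lambda>a b. f a * g b)"
| add: "eventually_poly2 F \<Longrightarrow> eventually_poly2 G \<Longrightarrow> eventually_poly2 (\<lambda>a b. F a b + G a b)"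

lemma eventually_poly2_zero: "eventually_poly2 (\<lambda>_ _. 0)"
  using eventually_poly2.prod[OF eventually_poly_const[of 0] eventually_poly_const[of 0]] by simp

lemma eventually_poly2_sum:
  "(\<And>i. i \<in> I \<Longrightarrow> eventually_poly2 (F i)) \<Longrightarrow> eventually_poly2 (\<lambda>a b. \<Sum>i\<in>I. F i a b)"
  by (induction I rule: infinite_finite_induct)
    (auto intro: eventually_poly2_zero eventually_poly2.add)

lemma eventually_poly2_swap: "eventually_poly2 F \<Longrightarrow> eventually_poly2 (\<lambda>a b. F b a)"
proof (induction rule: eventually_poly2.induct)
  case (prod f g)
  show ?case using eventually_poly2.prod[OF prod(2,1)] by (simp add: mult.commute)
qed (rule eventually_poly2.add)

lemma eventually_poly2_uminus: "eventually_poly2 F \<Longrightarrow> eventually_poly2 (\<lambda>a b. - F a b)"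
proof (induction rule: eventually_poly2.induct)
  case (prod f g)
  show ?case using eventually_poly2.prod[OF eventually_poly_cmult[OF prod(1), of "- 1"] prod(2)] by simp
next
  case (add F G)
  show ?case using eventually_poly2.add[OF add.IH] by simp
qed

lemma eventually_poly2_shift:
  "eventually_poly2 F \<Longrightarrow> eventually_poly2 (\<lambda>a b. if t \<le> a then F (a - t) b else 0)"
proof (induction rule: eventually_poly2.induct)
  case (prod f g)
  show ?case using eventually_poly2.prod[OF eventually_poly_shift[OF prod(1), of t] prod(2)]
    by (rule back_subst[of eventually_poly2]) auto
next
  case (add F G)
  show ?case using eventually_poly2.add[OF add.IH]
    by (rule back_subst[of eventually_poly2]) (auto simp: fun_eq_iff)
qed

lemma eventually_poly2_partial_sum:
  "eventually_poly2 F \<Longrightarrow> eventually_poly2 (\<lambda>a b. \<Sum>i\<le>a. F i b)"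
proof (induction rule: eventually_poly2.induct)
  case (prod f g)
  show ?case using eventually_poly2.prod[OF eventually_poly_partial_sum[OF prod(1)] prod(2)]
    by (simp add: sum_distrib_right)
next
  case (add F G)
  show ?case using eventually_poly2.add[OF add.IH] by (simp add: sum.distrib)
qed

text \<open>Replacing every \<open>F t\<close> by the limit \<open>F T\<close> leaves a partial sum;
  the error comes from the finitely many \<open>t < T\<close> and is a sum of shifted
  functions.\<close>

lemma eventually_poly2_convolution:
  assumes "\<And>t. eventually_poly2 (F t)" and stable: "\<And>t. t \<ge> T \<Longrightarrow> F t = F T"
  shows "eventually_poly2 (\<lambda>a b. \<Sum>t\<le>a. F t (a - t) b)"
proof -
  let ?D = "\<lambda>t a b. F t a b + - F T a b"
  have "(\<Sum>t\<le>a. F t (a - t) b)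
      = (\<Sum>i\<le>a. F T i b) + (\<Sum>t<T. if t \<le> a then ?D t (a - t) b else 0)" for a b
  proof -
    have "(\<Sum>t\<le>a. F t (a - t) b) = (\<Sum>t\<le>a. F T (a - t) b) + (\<Sum>t\<le>a. ?D t (a - t) b)"
      by (simp add: sum.distrib[symmetric])
    also have "(\<Sum>t\<le>a. F T (a - t) b) = (\<Sum>i\<le>a. F T i b)"
      by (rule sum.reindex_bij_witness[of _ "\<lambda>i. a - i" "\<lambda>i. a - i"]) auto
    also have "(\<Sum>t\<le>a. ?D t (a - t) b) = (\<Sum>t\<in>{..a} \<inter> {..<T}. ?D t (a - t) b)"
      by (rule sum.mono_neutral_right) (auto, metis not_less stable)
    also have "\<dots> = (\<Sum>t<T. if t \<le> a then ?D t (a - t) b else 0)"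
      by (subst Int_commute, subst sum.inter_restrict) auto
    finally show ?thesis .
  qed
  moreover have "eventually_poly2 (?D t)" for t
    by (intro eventually_poly2.add eventually_poly2_uminus assms(1))
  from eventually_poly2.add[OF eventually_poly2_partial_sum[OF assms(1)]
      eventually_poly2_sum[OF eventually_poly2_shift[OF this]]]
  have "eventually_poly2
      (\<lambda>a b. (\<Sum>i\<le>a. F T i b) + (\<Sum>t<T. if t \<le> a then ?D t (a - t) b else 0))" .
  ultimately show ?thesis by simp
qed

text \<open>The passage from distances \<open>a\<close>, \<open>b\<close> to a corner
  \<open>(c, c')\<close> back to the bidegrees themselves; \<open>s\<close> and \<open>s'\<close>
  are the signs of the two directions.\<close>

lemma eventually_poly2_imp_poly2:
  assumes "eventually_poly2 F" "s * s = 1" "s' * s' = 1"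
  shows "\<exists>P N. \<forall>a\<ge>N. \<forall>b\<ge>N. poly2 P (c + s * int a) (c' + s' * int b) = F a b"
  using assms(1)
proof (induction rule: eventually_poly2.induct)
  case (prod f g)
  obtain p N where p: "\<And>n. n \<ge> N \<Longrightarrow> f n = poly p (of_nat n)"
    using prod(1) unfolding eventually_poly_def by blast
  obtain q N' where q: "\<And>n. n \<ge> N' \<Longrightarrow> g n = poly q (of_nat n)"
    using prod(2) unfolding eventually_poly_def by blast
  \<comment> \<open>Inverse substitutions: \<open>u = c + s * a\<close> gives
    \<open>a = s * u - s * c\<close> because \<open>s * s = 1\<close>.\<close>
  define p' where "p' = pcompose p [:of_int (- s * c), of_int s:]"
  define q' where "q' = pcompose q [:of_int (- s' * c'), of_int s':]"
  have lin: "of_int (- r * d) + (of_int d + of_int r * of_nat x) * of_int r = (of_nat x :: rat)"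
    if "r * r = 1" for r d :: int and x
  proof -
    have "(of_int r * of_int r :: rat) = 1" using that by (metis of_int_1 of_int_mult)
    then show ?thesis by (simp add: algebra_simps)
  qed
  have const: "poly (map_poly (\<lambda>c. [:c:]) r) [:y:] = [:poly r y:]" for r :: "rat poly" and y
    by (induction r) (auto simp: map_poly_pCons)
  \<comment> \<open>\<open>poly2\<close> puts \<open>v\<close> into the outer variable, so
    \<open>q'\<close> is lifted coefficientwise while \<open>p'\<close> sits in the
    coefficients.\<close>
  have "poly2 (map_poly (\<lambda>c. [:c:]) q' * [:p':]) (c + s * int a) (c' + s' * int b) = f a * g b"
    if "a \<ge> max N N'" "b \<ge> max N N'" for a b
    using that lin[OF assms(2), of c a] lin[OF assms(3), of c' b]
    by (simp add: poly2_def const p'_def q'_def poly_pcompose p q)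
  then show ?case by blast
next
  case (add F G)
  obtain P N where P: "\<And>a b. a \<ge> N \<Longrightarrow> b \<ge> N \<Longrightarrow> poly2 P (c + s * int a) (c' + s' * int b) = F a b"
    using add.IH(1) by blast
  obtain Q N' where Q: "\<And>a b. a \<ge> N' \<Longrightarrow> b \<ge> N' \<Longrightarrow> poly2 Q (c + s * int a) (c' + s' * int b) = G a b"
    using add.IH(2) by blast
  have "poly2 (P + Q) (c + s * int a) (c' + s' * int b) = F a b + G a b"
    if "a \<ge> max N N'" "b \<ge> max N N'" for a b
    using that P[of a b] Q[of a b] by (simp add: poly2_def)
  then show ?case by blast
qed

section \<open>Counting points of down-sets\<close>

text \<open>Closure under lowering one coordinate by one. In each length the complement is the set
  of exponents of a monomial ideal.\<close>

definition downset :: "nat list set \<Rightarrow> bool" where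
  "downset S \<longleftrightarrow> (\<forall>\<alpha> i. i < length \<alpha> \<longrightarrow> \<alpha>[i := Suc (\<alpha> ! i)] \<in> S \<longrightarrow> \<alpha> \<in> S)"

lemma downset_slice: "downset S \<Longrightarrow> downset {\<alpha>. t # \<alpha> \<in> S}"
  unfolding downset_def
proof (intro allI impI)
  fix \<alpha> i
  assume S: "\<forall>\<alpha> i. i < length \<alpha> \<longrightarrow> \<alpha>[i := Suc (\<alpha> ! i)] \<in> S \<longrightarrow> \<alpha> \<in> S"
    and "i < length \<alpha>" "\<alpha>[i := Suc (\<alpha> ! i)] \<in> {\<alpha>. t # \<alpha> \<in> S}"
  then show "\<alpha> \<in> {\<alpha>. t # \<alpha> \<in> S}"
    using S[rule_format, of "Suc i" "t # \<alpha>"] by simp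
qed

lemma downset_slice_antimono:
  assumes "downset S" "t \<le> t'"
  shows "{\<alpha>. t' # \<alpha> \<in> S} \<subseteq> {\<alpha>. t # \<alpha> \<in> S}"
proof (rule lift_Suc_antimono_le[OF _ assms(2)])
  fix n show "{\<alpha>. Suc n # \<alpha> \<in> S} \<subseteq> {\<alpha>. n # \<alpha> \<in> S}"
    using assms(1)[unfolded downset_def, rule_format, of 0 "n # _"] by auto
qed

text \<open>Dickson's lemma. The slices \<open>S t u\<close> decrease in \<open>t\<close> and in \<open>u\<close>, so once the diagonal has
  stabilised at \<open>T\<close>, all the slices with \<open>t, u \<ge> T\<close> coincide.\<close>

lemma decseq_downsets_stable:
  assumes "\<And>t. downset (S t)" "\<And>t. S t \<subseteq> {\<alpha>. length \<alpha> = k}" "decseq S"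
  shows "\<exists>T. \<forall>t\<ge>T. S t = S T"
  using assms
proof (induction k arbitrary: S)
  case 0
  show ?case
  proof (cases "\<exists>T. S T = {}")
    case True
    then obtain T where "S T = {}" by blast
    then show ?thesis using decseqD[OF 0(3), of T] by blast
  next
    case False
    with 0(2) have "S t = {[]}" for t by fastforce
    then show ?thesis by simp
  qed
next
  case (Suc k)
  define R where "R t u = {\<alpha>. u # \<alpha> \<in> S t}" for t u
  have down: "downset (R t u)" for t u
    unfolding R_def by (rule downset_slice[OF Suc.prems(1)])
  have len: "R t u \<subseteq> {\<alpha>. length \<alpha> = k}" for t u
    using Suc.prems(2)[of t] by (auto simp: R_def)
  have mono: "R t' u' \<subseteq> R t u" if "t \<le> t'" "u \<le> u'" for t t' u u'
    using downset_slice_antimono[OF Suc.prems(1) that(2), of t'] decseqD[OF Suc.prems(3) that(1)]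
    by (auto simp: R_def)
  have "\<exists>T. \<forall>t\<ge>T. R t t = R T T"
    by (rule Suc.IH[of "\<lambda>t. R t t", OF down len]) (simp_all add: decseq_def mono)
  then obtain T where T: "\<And>t. t \<ge> T \<Longrightarrow> R t t = R T T" by blast
  have tail: "R t u = R T T" if "t \<ge> T" "u \<ge> T" for t u
    using mono[of T t T u] mono[of t "max t u" u "max t u"] T[of "max t u"] that by auto
  have "\<forall>u. \<exists>T. \<forall>t\<ge>T. R t u = R T u"
    by (intro allI Suc.IH[of "\<lambda>t. R t _", OF down len]) (simp_all add: decseq_def mono)
  then obtain \<tau> where \<tau>: "\<And>t u. t \<ge> \<tau> u \<Longrightarrow> R t u = R (\<tau> u) u" by metis
  \<comment> \<open>The slices with \<open>u < T\<close> stabilise one by one; the sum serves as a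
    common bound for their stabilisation points.\<close>
  define T' where "T' = T + (\<Sum>u<T. \<tau> u)"
  have \<tau>_le: "\<tau> u \<le> T'" if "u < T" for u
    using that member_le_sum[of u "{..<T}" \<tau>] by (simp add: T'_def)
  have "S t = S T'" if "t \<ge> T'" for t
  proof -
    have R: "R t u = R T' u" for u
    proof (cases "u < T")
      case True
      then show ?thesis using \<tau>[of u t] \<tau>[of u T'] \<tau>_le[OF True] that by simp
    next
      case False
      then show ?thesis using tail[of t u] tail[of T' u] that by (simp add: T'_def)
    qed
    have "\<alpha> \<in> S t \<longleftrightarrow> \<alpha> \<in> S T'" for \<alpha>
    proof (cases \<alpha>)
      case Nil
      then show ?thesis using Suc.prems(2) by fastforce
    next
      case (Cons u \<beta>)
      then show ?thesis using R[of u] by (auto simp: R_def)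
    qed
    then show ?thesis by blast
  qed
  then show ?case by blast
qed

text \<open>The labels \<open>ls\<close> say whether a coordinate counts towards the first (\<open>True\<close>) or the second
  (\<open>False\<close>) component of the bidegree.\<close>

fun label_degree :: "bool \<Rightarrow> bool list \<Rightarrow> nat list \<Rightarrow> nat" where
  "label_degree l (x # ls) (n # \<alpha>) = (if x = l then n else 0) + label_degree l ls \<alpha>"
| "label_degree l _ _ = 0"

definition bidegree_points :: "bool list \<Rightarrow> nat \<Rightarrow> nat \<Rightarrow> nat list set" where
  "bidegree_points ls a b =
     {\<alpha>. length \<alpha> = length ls \<and> label_degree True ls \<alpha> = a \<and> label_degree False ls \<alpha> = b}"

lemma bidegree_points_Nil: "bidegree_points [] a b = (if a = 0 \<and> b = 0 then {[]} else {})"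
  by (auto simp: bidegree_points_def)

text \<open>A first coordinate \<open>t\<close> with this label uses up \<open>t\<close> of the
  first degree, so counting slice by slice produces a convolution.\<close>

lemma bidegree_points_True:
  "bidegree_points (True # ls) a b = (\<Union>t\<le>a. (#) t ` bidegree_points ls (a - t) b)"
proof (rule set_eqI)
  fix \<alpha>
  show "\<alpha> \<in> bidegree_points (True # ls) a b \<longleftrightarrow>
      \<alpha> \<in> (\<Union>t\<le>a. (#) t ` bidegree_points ls (a - t) b)"
    by (cases \<alpha>) (auto simp: bidegree_points_def image_iff)
qed

lemma bidegree_points_False:
  "bidegree_points (False # ls) a b = (\<Union>t\<le>b. (#) t ` bidegree_points ls a (b - t))"
proof (rule set_eqI)
  fix \<alpha>
  show "\<alpha> \<in> bidegree_points (False # ls) a b \<longleftrightarrow>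
      \<alpha> \<in> (\<Union>t\<le>b. (#) t ` bidegree_points ls a (b - t))"
    by (cases \<alpha>) (auto simp: bidegree_points_def image_iff)
qed

lemma finite_bidegree_points: "finite (bidegree_points ls a b)"
proof (induction ls arbitrary: a b)
  case Nil
  then show ?case by (simp add: bidegree_points_Nil)
next
  case (Cons l ls)
  then show ?case by (cases l) (simp_all add: bidegree_points_True bidegree_points_False)
qed

lemma card_slices:
  assumes "finite I" "\<And>t. t \<in> I \<Longrightarrow> finite (B t)"
  shows "card (S \<inter> (\<Union>t\<in>I. (#) t ` B t)) = (\<Sum>t\<in>I. card ({\<alpha>. t # \<alpha> \<in> S} \<inter> B t))"
proof -
  have "S \<inter> (\<Union>t\<in>I. (#) t ` B t) = (\<Union>t\<in>I. (#) t ` ({\<alpha>. t # \<alpha> \<in> S} \<inter> B t))"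
    by auto
  also have "card \<dots> = (\<Sum>t\<in>I. card ((#) t ` ({\<alpha>. t # \<alpha> \<in> S} \<inter> B t)))"
    by (rule card_UN_disjoint) (use assms in auto)
  also have "\<dots> = (\<Sum>t\<in>I. card ({\<alpha>. t # \<alpha> \<in> S} \<inter> B t))"
    by (intro sum.cong refl card_image) auto
  finally show ?thesis .
qed

text \<open>This is the Hilbert function of a monomial quotient of a polynomial ring. Induction on
  the number of variables: the slices of \<open>S\<close> by the first exponent decrease and so
  stabilise, and the count is a convolution of their counts.\<close>

lemma eventually_poly2_card_downset:
  assumes "downset S"
  shows "eventually_poly2 (\<lambda>a b. of_nat (card (S \<inter> bidegree_points ls a b)))"
  using assms
proof (induction ls arbitrary: S)
  case Nil
  define c :: rat where "c = of_nat (card (S \<inter> {[]}))"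
  have "eventually_poly2 (\<lambda>a b. (c * (if a = 0 then 1 else 0)) * (if b = 0 then 1 else 0))"
    by (intro eventually_poly2.prod eventually_poly_cmult eventually_poly_delta)
  then show ?case
    by (rule back_subst[of eventually_poly2]) (auto simp: c_def bidegree_points_Nil fun_eq_iff)
next
  case (Cons l ls)
  \<comment> \<open>Cutting down to one length makes \<open>decseq_downsets_stable\<close>
    applicable; by \<open>len\<close> no counted point is lost.\<close>
  let ?S = "\<lambda>t. {\<alpha>. t # \<alpha> \<in> S} \<inter> {\<alpha>. length \<alpha> = length ls}"
  have len: "?S t \<inter> bidegree_points ls a b = {\<alpha>. t # \<alpha> \<in> S} \<inter> bidegree_points ls a b" for t a b
    by (auto simp: bidegree_points_def)
  define F where "F t a b = (of_nat (card (?S t \<inter> bidegree_points ls a b)) :: rat)" for t a b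
  have down: "downset (?S t)" for t
    using downset_slice[OF Cons.prems, of t] by (auto simp: downset_def)
  have F: "eventually_poly2 (F t)" for t
    unfolding F_def by (rule Cons.IH[OF down])
  have "decseq ?S"
    using downset_slice_antimono[OF Cons.prems] unfolding decseq_def by blast
  then obtain T where T: "\<And>t. t \<ge> T \<Longrightarrow> ?S t = ?S T"
    using decseq_downsets_stable[of ?S, OF down] by blast
  have stable: "F t = F T" if "t \<ge> T" for t
    using T[OF that] by (simp add: F_def fun_eq_iff)
  show ?case
  proof (cases l)
    case True
    then show ?thesis
      using eventually_poly2_convolution[of F, OF F stable]
      by (simp add: bidegree_points_True card_slices finite_bidegree_points F_def len)
  next
    case False
    \<comment> \<open>The label \<open>False\<close> is the same argument with the roles of
      \<open>a\<close> and \<open>b\<close> exchanged.\<close>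
    have "eventually_poly2 (\<lambda>b a. \<Sum>t\<le>b. F t a (b - t))"
      by (rule eventually_poly2_convolution[of "\<lambda>t b a. F t a b" T, OF eventually_poly2_swap[OF F]])
        (drule stable, simp)
    from eventually_poly2_swap[OF this] show ?thesis
      using False
      by (simp add: bidegree_points_False card_slices finite_bidegree_points F_def len)
  qed
qed

section \<open>Hilbert functions of finitely generated families of commuting operators\<close>

text \<open>Greedy choice of a basis: a vector is kept exactly when the earlier ones do not span
  it.\<close>

lemma (in vector_space) dim_span_image_eq_card:
  fixes v :: "'i::linorder \<Rightarrow> 'b"
  assumes "finite I"
  shows "dim (span (v ` I)) = card {i \<in> I. v i \<notin> span (v ` {j \<in> I. j < i})}"
proof -
  define S where "S I = {i \<in> I. v i \<notin> span (v ` {j \<in> I. j < i})}" for I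
  have "independent (v ` S I) \<and> inj_on v (S I) \<and> span (v ` S I) = span (v ` I)"
    using assms
  proof (induction I rule: finite_linorder_max_induct)
    case empty
    then show ?case by (simp add: S_def independent_empty)
  next
    case (insert m A)
    have "m \<notin> A" using insert.hyps by auto
    have "{j \<in> insert m A. j < i} = {j \<in> A. j < i}" if "i \<in> A" for i
      using insert.hyps that by auto
    moreover have "{j \<in> insert m A. j < m} = A"
      using insert.hyps by auto
    \<comment> \<open>Adding a new maximal index does not change the selection among the old
      ones.\<close>
    ultimately have S: "S (insert m A) = (if v m \<in> span (v ` A) then S A else insert m (S A))"
      using \<open>m \<notin> A\<close> unfolding S_def by auto
    show ?case
    proof (cases "v m \<in> span (v ` A)")
      case True
      then show ?thesis using S insert.IH by (simp add: span_redundant)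
    next
      case False
      then have "v m \<notin> span (v ` S A)" using insert.IH by simp
      moreover from this have "v m \<notin> v ` S A" using span_base by blast
      moreover have "span (insert (v m) (v ` S A)) = span (insert (v m) (v ` A))"
        using insert.IH by (simp add: span_insert)
      moreover have "m \<notin> S A" using \<open>m \<notin> A\<close> by (simp add: S_def)
      ultimately show ?thesis
        using S False insert.IH by (simp add: independent_insertI)
    qed
  qed
  then have "dim (span (v ` I)) = card (v ` S I)" "inj_on v (S I)"
    by (metis dim_span_eq_card_independent)+
  then show ?thesis
    by (simp add: card_image S_def)
qed

text \<open>The lexicographic order is a monomial order: multiplying two monomials by the same
  variable preserves strict inequality.\<close>

lemma raise_less_raise:
  fixes \<alpha> \<beta> :: "nat list"
  assumes "\<alpha> < \<beta>" "length \<alpha> = length \<beta>"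
  shows "\<alpha>[i := Suc (\<alpha> ! i)] < \<beta>[i := Suc (\<beta> ! i)]"
  using assms
proof (induction \<alpha> arbitrary: \<beta> i)
  case (Cons a \<alpha>)
  then obtain b \<beta>' where "\<beta> = b # \<beta>'" by (cases \<beta>) auto
  with Cons show ?case by (cases i) auto
qed simp

section \<open>Degrees of exponents under multiplication by a variable\<close>

lemma label_degree_raise:
  assumes "i < length ls" "length \<alpha> = length ls"
  shows "label_degree l ls (\<alpha>[i := Suc (\<alpha> ! i)]) = label_degree l ls \<alpha> + (if ls ! i = l then 1 else 0)"
  using assms
proof (induction ls arbitrary: \<alpha> i)
  case (Cons x ls)
  then obtain n \<beta> where "\<alpha> = n # \<beta>" by (cases \<alpha>) auto
  with Cons show ?case by (cases i) auto
qed simp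

lemma label_degree_pos:
  assumes "label_degree l ls \<alpha> > 0" "length \<alpha> = length ls"
  shows "\<exists>i < length ls. ls ! i = l \<and> \<alpha> ! i > 0"
  using assms
proof (induction ls arbitrary: \<alpha>)
  case (Cons x ls)
  then obtain n \<beta> where \<alpha>: "\<alpha> = n # \<beta>" by (cases \<alpha>) auto
  show ?case
  proof (cases "x = l \<and> n > 0")
    case True
    then show ?thesis using \<alpha> by (intro exI[of _ 0]) simp
  next
    case False
    then have "label_degree l ls \<beta> > 0" using Cons.prems \<alpha> by (auto split: if_splits)
    then obtain i where "i < length ls" "ls ! i = l" "\<beta> ! i > 0"
      using Cons.IH Cons.prems \<alpha> by auto
    then show ?thesis using \<alpha> by (intro exI[of _ "Suc i"]) simp
  qed
qed simp

text \<open>A point of positive \<open>l\<close>-degree has a positive coordinate with label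
  \<open>l\<close>, and lowering it gives a predecessor. The conditionals cover a step in either
  degree.\<close>

lemma bidegree_points_step:
  "bidegree_points ls (if l then Suc a else a) (if l then b else Suc b) =
     {\<alpha>[i := Suc (\<alpha> ! i)] | \<alpha> i. \<alpha> \<in> bidegree_points ls a b \<and> i < length ls \<and> ls ! i = l}"
  (is "?L = ?R")
proof
  show "?R \<subseteq> ?L"
    by (auto simp: bidegree_points_def label_degree_raise)
  show "?L \<subseteq> ?R"
  proof
    fix \<alpha> assume \<alpha>: "\<alpha> \<in> ?L"
    then have len: "length \<alpha> = length ls" and "label_degree l ls \<alpha> > 0"
      by (auto simp: bidegree_points_def split: if_splits)
    then obtain i where i: "i < length ls" "ls ! i = l" "\<alpha> ! i > 0"
      using label_degree_pos by blast
    define \<beta> where "\<beta> = \<alpha>[i := \<alpha> ! i - 1]"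
    have \<alpha>_eq: "\<alpha> = \<beta>[i := Suc (\<beta> ! i)]" and len': "length \<beta> = length ls"
      using i len by (simp_all add: \<beta>_def)
    have "\<beta> \<in> bidegree_points ls a b"
      using \<alpha> label_degree_raise[OF i(1) len'] i(2) len' unfolding \<alpha>_eq[symmetric]
      by (cases l) (auto simp: bidegree_points_def)
    with \<alpha>_eq i show "\<alpha> \<in> ?R" by blast
  qed
qed

section \<open>Monomials in commuting operators\<close>

fun apply_monomial :: "('x \<times> ('b \<Rightarrow> 'b)) list \<Rightarrow> nat list \<Rightarrow> 'b \<Rightarrow> 'b" where
  "apply_monomial ((_, h) # ops) (n # \<alpha>) x = (h ^^ n) (apply_monomial ops \<alpha> x)"
| "apply_monomial _ _ x = x"

lemma apply_monomial_replicate_zero: "apply_monomial ops (replicate n 0) x = x"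
proof (induction ops arbitrary: n)
  case (Cons op ops)
  then show ?case by (cases op; cases n) simp_all
qed simp

text \<open>Commutativity lets the extra factor pass through the powers to its left and be applied
  last.\<close>

lemma apply_monomial_raise:
  assumes "\<forall>p\<in>set ops. \<forall>q\<in>set ops. \<forall>x. snd p (snd q x) = snd q (snd p x)"
    and "i < length ops" "length \<alpha> = length ops"
  shows "apply_monomial ops (\<alpha>[i := Suc (\<alpha> ! i)]) x = snd (ops ! i) (apply_monomial ops \<alpha> x)"
  using assms
proof (induction ops arbitrary: \<alpha> i)
  case (Cons op ops)
  obtain l h where op: "op = (l, h)" by (cases op)
  obtain n \<beta> where \<alpha>: "\<alpha> = n # \<beta>" using Cons.prems(3) by (cases \<alpha>) auto
  show ?case
  proof (cases i)
    case 0
    then show ?thesis using op \<alpha> by simp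
  next
    case (Suc j)
    obtain l' h' where h': "ops ! j = (l', h')" by (cases "ops ! j")
    have "(l', h') \<in> set ops" using Cons.prems(2) Suc h' by (metis Suc_less_eq length_Cons nth_mem)
    then have "h (h' y) = h' (h y)" for y
      using Cons.prems(1) op by force
    then have "(h ^^ n) (h' y) = h' ((h ^^ n) y)" for y
      by (induction n) auto
    moreover have "apply_monomial ops (\<beta>[j := Suc (\<beta> ! j)]) x = h' (apply_monomial ops \<beta> x)"
      using Cons.IH[of j \<beta>] Cons.prems Suc \<alpha> h' by simp
    ultimately show ?thesis using op \<alpha> Suc h' by simp
  qed
qed simp

text \<open>Linear maps send spans to spans, so the images of generators suffice.\<close>

lemma (in vector_space) span_Union_image_span:
  assumes "\<And>h. h \<in> H \<Longrightarrow> module_hom scale scale h"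
  shows "span (\<Union>h\<in>H. h ` span G) = span (\<Union>h\<in>H. h ` G)"
proof -
  have "h ` span G \<subseteq> span (\<Union>h\<in>H. h ` G)" if "h \<in> H" for h
    unfolding module_hom.span_image[OF assms[OF that], symmetric]
    by (rule span_mono) (use that in blast)
  then show ?thesis
    unfolding span_eq
    by (intro conjI UN_least order_trans[OF UN_mono[OF order_refl image_mono[OF span_superset]] span_superset])
qed

text \<open>The monomials that are not linear combinations of smaller ones of the same bidegree form a
  basis, and for each generator their exponents form a down-set.\<close>

lemma (in vector_space) eventually_poly2_dim:
  fixes ops :: "(bool \<times> ('b \<Rightarrow> 'b)) list" and N :: "nat \<Rightarrow> nat \<Rightarrow> 'b set"
  assumes hom: "\<forall>p\<in>set ops. module_hom scale scale (snd p)"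
    and comm: "\<forall>p\<in>set ops. \<forall>q\<in>set ops. \<forall>x. snd p (snd q x) = snd q (snd p x)"
    and N0: "finite B" "N 0 0 = span B"
    and N_Suc1: "\<And>a b. N (Suc a) b = span (\<Union>h\<in>{h. (True, h) \<in> set ops}. h ` N a b)"
    and N_Suc2: "\<And>a b. N a (Suc b) = span (\<Union>h\<in>{h. (False, h) \<in> set ops}. h ` N a b)"
  shows "\<exists>C. finite C \<and> N a b = span C" and "eventually_poly2 (\<lambda>a b. of_nat (dim (N a b)))"
proof -
  define ls where "ls = map fst ops"
  have len_ls: "length ls = length ops" by (simp add: ls_def)
  obtain bs where bs: "set bs = B" using N0(1) finite_list by blast
  define r where "r = length bs"
  \<comment> \<open>An index \<open>j\<close> is a list: its head numbers a generator, its tail is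
    the exponent of the monomial applied to that generator.\<close>
  define v where "v j = apply_monomial ops (tl j) (bs ! hd j)" for j
  define J where "J a b = (\<Union>c<r. (#) c ` bidegree_points ls a b)" for a b
  have fin_J: "finite (J a b)" for a b
    by (simp add: J_def finite_bidegree_points)
  have v_raise: "v (c # \<alpha>[i := Suc (\<alpha> ! i)]) = snd (ops ! i) (v (c # \<alpha>))"
    if "i < length ops" "length \<alpha> = length ops" for c \<alpha> i
    using apply_monomial_raise[OF comm that] by (simp add: v_def)
  \<comment> \<open>The monomials of the next degree are exactly the images of the present ones
    under the operators with label \<open>l\<close>.\<close>
  have step: "v ` J (if l then Suc a else a) (if l then b else Suc b)
      = (\<Union>h\<in>{h. (l, h) \<in> set ops}. h ` v ` J a b)" (is "?L = ?R") for l a b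
  proof
    have raise: "snd (ops ! i) (v (c # \<alpha>)) = v (c # \<alpha>[i := Suc (\<alpha> ! i)])"
      if "i < length ls" "\<alpha> \<in> bidegree_points ls a b" for c \<alpha> i
      using v_raise that by (simp add: bidegree_points_def len_ls)
    have ops: "(l, h) \<in> set ops \<longleftrightarrow> (\<exists>i < length ls. ls ! i = l \<and> snd (ops ! i) = h)" for h
      by (auto simp: in_set_conv_nth ls_def prod_eq_iff)
    show "?L \<subseteq> ?R"
    proof
      fix x assume "x \<in> ?L"
      then obtain c \<alpha> i where *: "c < r" "\<alpha> \<in> bidegree_points ls a b" "i < length ls" "ls ! i = l"
        and x: "x = v (c # \<alpha>[i := Suc (\<alpha> ! i)])"
        unfolding J_def bidegree_points_step by blast
      have J: "c # \<alpha> \<in> J a b" using * by (auto simp: J_def)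
      have h: "snd (ops ! i) \<in> {h. (l, h) \<in> set ops}" using * ops by blast
      have "x = snd (ops ! i) (v (c # \<alpha>))" using raise * x by simp
      then show "x \<in> ?R" using UN_I[OF h imageI[OF imageI[OF J]]] by simp
    qed
    show "?R \<subseteq> ?L"
    proof
      fix x assume "x \<in> ?R"
      then obtain h j where h: "(l, h) \<in> set ops" and j: "j \<in> J a b" and x: "x = h (v j)"
        by auto
      from h obtain i where i: "i < length ls" "ls ! i = l" "snd (ops ! i) = h"
        using ops by blast
      from j obtain c \<alpha> where c: "c < r" and \<alpha>: "\<alpha> \<in> bidegree_points ls a b" and j_eq: "j = c # \<alpha>"
        unfolding J_def by blast
      have "c # \<alpha>[i := Suc (\<alpha> ! i)] \<in> J (if l then Suc a else a) (if l then b else Suc b)"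
        unfolding J_def bidegree_points_step using c \<alpha> i by blast
      moreover have "x = v (c # \<alpha>[i := Suc (\<alpha> ! i)])" using raise[OF i(1) \<alpha>] i x j_eq by simp
      ultimately show "x \<in> ?L" by (metis imageI)
    qed
  qed
  have span_step: "span (\<Union>h\<in>{h. (l, h) \<in> set ops}. h ` span (v ` J a b))
      = span (v ` J (if l then Suc a else a) (if l then b else Suc b))" for l a b
    unfolding step by (rule span_Union_image_span) (use hom in force)
  \<comment> \<open>The edge \<open>a = 0\<close> is reached by steps in \<open>b\<close>, every
    other bidegree by steps in \<open>a\<close>.\<close>
  have N: "N a b = span (v ` J a b)" for a b
  proof (induction a)
    case 0
    show ?case
    proof (induction b)
      case 0
      have zero: "bidegree_points ls 0 0 = {replicate (length ls) 0}"
      proof (induction ls)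
        case (Cons l ls)
        then show ?case by (cases l) (simp_all add: bidegree_points_True bidegree_points_False)
      qed (simp add: bidegree_points_Nil)
      have "v (c # replicate (length ls) 0) = bs ! c" for c
        by (simp add: v_def apply_monomial_replicate_zero)
      moreover have "J 0 0 = (\<lambda>c. c # replicate (length ls) 0) ` {..<r}"
        by (auto simp: J_def zero)
      ultimately have "v ` J 0 0 = (\<lambda>c. bs ! c) ` {..<r}"
        by (simp only: image_image)
      also have "\<dots> = B"
        unfolding bs[symmetric] r_def by (auto simp: set_conv_nth)
      finally show ?case using N0(2) by simp
    next
      case (Suc b)
      then show ?case using span_step[where l = False and a = 0 and b = b] by (simp add: N_Suc2)
    qed
  next
    case (Suc a)
    then show ?case using span_step[where l = True and a = a and b = b] by (simp add: N_Suc1)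
  qed
  show "\<exists>C. finite C \<and> N a b = span C"
    by (rule exI[of _ "v ` J a b"]) (simp add: N fin_J)
  \<comment> \<open>Standard monomials, selected as in \<open>dim_span_image_eq_card\<close>. The
    bidegree is read off from the index, so that one set serves all bidegrees.\<close>
  define St where "St = {j. length (tl j) = length ops \<and>
    v j \<notin> span (v ` {j' \<in> J (label_degree True ls (tl j)) (label_degree False ls (tl j)). j' < j})}"
  have "downset {\<alpha>. c # \<alpha> \<in> St}" for c
    unfolding downset_def
  proof (intro allI impI)
    fix \<alpha> i assume i: "i < length \<alpha>" and raised: "\<alpha>[i := Suc (\<alpha> ! i)] \<in> {\<alpha>. c # \<alpha> \<in> St}"
    then have len: "length \<alpha> = length ops" by (simp add: St_def)
    define a b where "a = label_degree True ls \<alpha>" and "b = label_degree False ls \<alpha>"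
    let ?\<alpha>' = "\<alpha>[i := Suc (\<alpha> ! i)]" and ?h = "snd (ops ! i)"
    let ?a' = "if ls ! i then Suc a else a" and ?b' = "if ls ! i then b else Suc b"
    have h: "module_hom scale scale ?h"
      using hom i len by simp
    have deg: "label_degree True ls ?\<alpha>' = ?a'" "label_degree False ls ?\<alpha>' = ?b'"
      using i len by (simp_all add: label_degree_raise len_ls a_def b_def)
    \<comment> \<open>If a monomial depends on smaller ones, applying an operator shows that its
      multiple depends on the multiples of these, which are again smaller.\<close>
    have "v (c # \<alpha>) \<notin> span (v ` {j \<in> J a b. j < c # \<alpha>})"
    proof
      assume "v (c # \<alpha>) \<in> span (v ` {j \<in> J a b. j < c # \<alpha>})"
      then have "v (c # ?\<alpha>') \<in> span (?h ` v ` {j \<in> J a b. j < c # \<alpha>})"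
        using v_raise[of i \<alpha> c] i len unfolding module_hom.span_image[OF h] by simp
      moreover have "?h ` v ` {j \<in> J a b. j < c # \<alpha>} \<subseteq> v ` {j \<in> J ?a' ?b'. j < c # ?\<alpha>'}"
      proof
        fix x assume "x \<in> ?h ` v ` {j \<in> J a b. j < c # \<alpha>}"
        then obtain d \<beta> where \<beta>: "d < r" "\<beta> \<in> bidegree_points ls a b" "d # \<beta> < c # \<alpha>"
          "x = ?h (v (d # \<beta>))"
          by (auto simp: J_def)
        have len_\<beta>: "length \<beta> = length ops" using \<beta>(2) by (simp add: bidegree_points_def len_ls)
        \<comment> \<open>The head is the generator number, so coordinate \<open>i\<close> of the
          exponent has position \<open>Suc i\<close>.\<close>
        have less: "d # \<beta>[i := Suc (\<beta> ! i)] < c # ?\<alpha>'"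
          using raise_less_raise[OF \<beta>(3), of "Suc i"] len len_\<beta> by simp
        have mem: "d # \<beta>[i := Suc (\<beta> ! i)] \<in> J ?a' ?b'"
          unfolding J_def bidegree_points_step using \<beta>(1,2) i len len_ls by auto
        have "x = v (d # \<beta>[i := Suc (\<beta> ! i)])"
          using \<beta>(4) v_raise[of i \<beta> d] i len len_\<beta> by simp
        then show "x \<in> v ` {j \<in> J ?a' ?b'. j < c # ?\<alpha>'}"
          by (rule image_eqI) (rule CollectI, rule conjI[OF mem less])
      qed
      ultimately have "v (c # ?\<alpha>') \<in> span (v ` {j \<in> J ?a' ?b'. j < c # ?\<alpha>'})"
        by (rule subsetD[OF span_mono, rotated])
      with raised show False by (simp add: St_def deg)
    qed
    then show "\<alpha> \<in> {\<alpha>. c # \<alpha> \<in> St}"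
      using len by (simp add: St_def a_def b_def)
  qed
  then have "eventually_poly2 (\<lambda>a b. \<Sum>c<r. of_nat (card ({\<alpha>. c # \<alpha> \<in> St} \<inter> bidegree_points ls a b)))"
    by (intro eventually_poly2_sum eventually_poly2_card_downset)
  moreover have "dim (N a b) = (\<Sum>c<r. card ({\<alpha>. c # \<alpha> \<in> St} \<inter> bidegree_points ls a b))" for a b
  proof -
    \<comment> \<open>On \<open>J a b\<close> the degrees read off by \<open>St\<close> are
      \<open>a\<close> and \<open>b\<close>, so \<open>St\<close> selects precisely the greedy
      basis.\<close>
    have "{j \<in> J a b. v j \<notin> span (v ` {j' \<in> J a b. j' < j})} = St \<inter> J a b"
      by (auto simp: J_def St_def bidegree_points_def len_ls)
    then have "dim (N a b) = card (St \<inter> J a b)"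
      unfolding N by (simp only: dim_span_image_eq_card[OF fin_J])
    also have "\<dots> = (\<Sum>c<r. card ({\<alpha>. c # \<alpha> \<in> St} \<inter> bidegree_points ls a b))"
      unfolding J_def by (rule card_slices) (simp_all add: finite_bidegree_points)
    finally show ?thesis .
  qed
  ultimately show "eventually_poly2 (\<lambda>a b. of_nat (dim (N a b)))" by simp
qed

section \<open>Relations in the Weyl algebra\<close>

text \<open>Identities between additive operators on polynomials can thus be checked on single
  terms.\<close>

lemma additive_eq_if_eq_single:
  fixes F G :: "('a \<Rightarrow>\<^sub>0 'b::ab_group_add) \<Rightarrow> 'c::ab_group_add"
  assumes "\<And>p q. F (p + q) = F p + F q" "\<And>p q. G (p + q) = G p + G q"
    and "\<And>t c. F (Poly_Mapping.single t c) = G (Poly_Mapping.single t c)"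
  shows "F p = G p"
proof (induction p rule: update_induct)
  case const
  show ?case using assms(1)[of 0 0] assms(2)[of 0 0] by simp
next
  case (update f a b)
  then have "Poly_Mapping.update a b f = f + Poly_Mapping.single a b"
    by (intro poly_mapping_eqI) (auto simp: lookup_update lookup_add lookup_single in_keys_iff when_def)
  then show ?case using update assms by simp
qed

lemma partial_single:
  "partial i (Poly_Mapping.single t c) =
     Poly_Mapping.single (t - Poly_Mapping.single i 1) (of_nat (Poly_Mapping.lookup t i) * c)"
  by (subst partial_superset[of "{t}"]) auto

lemma partial_mconst: "partial i (mconst c * p) = mconst c * partial i p"
  by (rule additive_eq_if_eq_single[of "\<lambda>p. partial i (mconst c * p)"])
    (simp_all add: distrib_left partial_add partial_single mconst_def mult_single mult.left_commute)

lemma partial_commute: "partial i (partial j p) = partial j (partial i p)"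
proof (cases "i = j")
  case False
  have eq: "t - Poly_Mapping.single j (Suc 0) - Poly_Mapping.single i (Suc 0)
      = t - Poly_Mapping.single i (Suc 0) - Poly_Mapping.single j (Suc 0)" for t
    by (rule poly_mapping_eqI) (simp add: lookup_minus)
  show ?thesis
    by (rule additive_eq_if_eq_single[of "\<lambda>p. partial i (partial j p)"])
      (use False eq in \<open>simp_all add: partial_add partial_single lookup_minus lookup_single when_def
        mult.left_commute\<close>)
qed simp

text \<open>Subtraction of exponents is truncated, hence the assumption that \<open>i\<close> occurs
  in \<open>t\<close>.\<close>

lemma single_plus_minus_single:
  assumes "Poly_Mapping.lookup t i \<noteq> (0::nat)"
  shows "Poly_Mapping.single j 1 + (t - Poly_Mapping.single i 1)
    = Poly_Mapping.single j 1 + t - Poly_Mapping.single i 1"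
  using assms by (intro poly_mapping_eqI) (auto simp: lookup_add lookup_minus lookup_single when_def)

text \<open>The product rule for a variable, from which the commutation relation
  \<open>wpartial_wvar\<close> follows.\<close>

lemma partial_mvar:
  fixes p :: "('k::field_char_0, 'i) mpoly"
  shows "partial i (mvar j * p) = mvar j * partial i p + (if i = j then p else 0)"
proof (rule additive_eq_if_eq_single[of "\<lambda>p. partial i (mvar j * p)"])
  fix t and c :: 'k
  show "partial i (mvar j * Poly_Mapping.single t c)
      = mvar j * partial i (Poly_Mapping.single t c) + (if i = j then Poly_Mapping.single t c else 0)"
  proof (cases "Poly_Mapping.lookup t i = 0")
    case True
    then show ?thesis
      by (simp add: mvar_def partial_single mult_single lookup_add lookup_single)
  next
    case False
    then have eq: "Poly_Mapping.single j 1 + (t - Poly_Mapping.single i 1)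
        = Poly_Mapping.single j 1 + t - Poly_Mapping.single i 1"
      by (rule single_plus_minus_single)
    show ?thesis
      using eq by (cases "i = j")
        (simp_all add: mvar_def partial_single mult_single lookup_add lookup_single
          single_add[symmetric] algebra_simps)
  qed
qed (simp_all add: distrib_left partial_add)

section \<open>Constants and generators in the Weyl algebra\<close>

lemma mconst_add: "mconst (a + b) = mconst a + mconst b"
  and mconst_mult: "mconst (a * b) = mconst a * mconst b"
  and mconst_zero: "mconst 0 = 0"
  and mconst_one: "mconst 1 = 1"
  by (simp_all add: mconst_def single_add mult_single)

lemma wmult_add: "wmult (p + q) = wmult p + wmult q"
  and wmult_mult: "wmult (p * q) = wmult p * wmult q"
  and wmult_zero: "wmult 0 = 0"
  and wmult_one: "wmult 1 = 1"
  by (transfer; simp add: fun_eq_iff distrib_right mult.assoc)+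

text \<open>The generating operators commute with constants, and sums and composites inherit this.
  Hence elements of the Weyl algebra act linearly over \<open>K\<close>.\<close>

lemma wconst_commute: "wconst c * P = P * wconst c"
proof transfer
  fix c and P :: "('a, 'b) mpoly \<Rightarrow> ('a, 'b) mpoly"
  assume "P \<in> weyl_ops"
  then show "(\<lambda>q. mconst c * P q) = (\<lambda>q. P (mconst c * q))"
    by (induction rule: weyl_ops.induct)
      (auto simp: fun_eq_iff partial_mconst distrib_left mult.left_commute)
qed

lemma wconst_of_nat: "wconst (of_nat n) = of_nat n"
  by (induction n)
    (simp_all add: mconst_zero mconst_add mconst_one wmult_add wmult_zero wmult_one)

lemma wconst_of_int: "wconst (of_int z) = of_int z"
proof (cases z)
  case (nonneg n)
  then show ?thesis by (simp add: wconst_of_nat)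
next
  case (neg n)
  have "wconst (of_int z) + wconst (of_nat (Suc n)) = 0"
    unfolding wmult_add[symmetric] mconst_add[symmetric]
    by (simp add: neg mconst_zero wmult_zero)
  then have "wconst (of_int z) = - of_nat (Suc n)"
    unfolding wconst_of_nat by (rule eq_neg_iff_add_eq_0[THEN iffD2])
  then show ?thesis by (simp add: neg)
qed

lemma wvar_commute: "wvar i * wvar j = wvar j * wvar i"
  unfolding wmult_mult[symmetric] by (simp add: mult.commute)

lemma wpartial_commute: "wpartial i * wpartial j = wpartial j * wpartial i"
  by transfer (simp add: partial_commute fun_eq_iff)

lemma wpartial_wvar: "wpartial i * wvar j = wvar j * wpartial i + (if i = j then 1 else 0)"
  by transfer (auto simp: partial_mvar fun_eq_iff)

text \<open>The generator leading away from the corner of a quadrant; \<open>s\<close> says whether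
  the degree grows in that direction.\<close>

definition raise_op :: "bool \<Rightarrow> 'i \<Rightarrow> ('k::field_char_0, 'i) weyl" where
  "raise_op s x = (if s then wvar x else wpartial x)"

text \<open>Only a variable and its own derivative fail to commute. Within a block the signs will
  agree, and across blocks the indices differ.\<close>

lemma raise_op_commute:
  "s = s' \<or> x \<noteq> x' \<Longrightarrow> raise_op s x * raise_op s' x' = raise_op s' x' * raise_op s x"
  unfolding raise_op_def by (auto simp: wvar_commute wpartial_commute wpartial_wvar)

section \<open>Modules over the Weyl algebra as vector spaces\<close>

context left_module
begin

lemma act_zero_left: "act 0 x = 0"
  using act_add_left[of 0 0 x] by simp

lemma act_diff_left: "act (r - s) x = act r x - act s x"
  using act_add_left[of "r - s" s x] by simp

lemma act_sum_left: "act (sum f I) x = (\<Sum>i\<in>I. act (f i) x)"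
  by (induction I rule: infinite_finite_induct) (auto simp: act_zero_left act_add_left)

end

lemma left_module_times: "left_module ((*) :: 'r::ring_1 \<Rightarrow> 'r \<Rightarrow> 'r)"
  by unfold_locales (auto simp: algebra_simps)

lemma vector_space_kscale:
  fixes act :: "('k::field_char_0, 'i) weyl \<Rightarrow> 'v::ab_group_add \<Rightarrow> 'v"
  assumes "left_module act"
  shows "vector_space (kscale act)"
proof -
  interpret left_module act by fact
  show ?thesis
    by unfold_locales
      (simp_all add: kscale_def act_add_right act_add_left act_one act_mult[symmetric]
        mconst_add mconst_mult mconst_one wmult_add wmult_mult wmult_one)
qed

lemma module_hom_act:
  fixes act :: "('k::field_char_0, 'i) weyl \<Rightarrow> 'v::ab_group_add \<Rightarrow> 'v"
  assumes "left_module act"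
  shows "module_hom (kscale act) (kscale act) (act P)"
proof -
  interpret left_module act by fact
  interpret vector_space "kscale act" by (rule vector_space_kscale) fact
  show ?thesis
    by unfold_locales (simp_all add: act_add_right kscale_def act_mult[symmetric] wconst_commute)
qed

section \<open>Generalized Eulerian modules\<close>

text \<open>Modulo \<open>W\<close> the operator \<open>E\<close> is the scalar \<open>- c\<close>, while its only generalized eigenvalue is
  \<open>u \<noteq> - c\<close>.\<close>

lemma nilpotent_shift_imp_mem:
  fixes act :: "('k::field_char_0, 'i) weyl \<Rightarrow> 'v::ab_group_add \<Rightarrow> 'v"
  assumes "left_module act" "ksubspace act V" "ksubspace act W"
    and V: "\<And>e. e \<in> V \<Longrightarrow> act E e \<in> V"
    and W: "\<And>e. e \<in> V \<Longrightarrow> act (E + of_int c) e \<in> W"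
    and "u + c \<noteq> 0" "e \<in> V" "act ((E - of_int u) ^ a) e = 0"
  shows "e \<in> W"
proof -
  interpret left_module act by fact
  interpret vector_space "kscale act" by (rule vector_space_kscale) fact
  have of_int: "act (of_int z) x = kscale act (of_int z) x" for z x
    by (simp add: kscale_def wconst_of_int)
  show ?thesis
    using assms(7,8)
  proof (induction a arbitrary: e)
    case 0
    then show ?case using subspace_0[OF assms(3)] by (simp add: act_one)
  next
    case (Suc a)
    \<comment> \<open>\<open>e'\<close> is killed by a smaller power, so it lies in \<open>W\<close>
      by induction; subtracting it from \<open>act (E + of_int c) e\<close> leaves
      \<open>u + c\<close> times \<open>e\<close>.\<close>
    define e' where "e' = act (E - of_int u) e"
    have "act ((E - of_int u) ^ a) e' = 0"
      using Suc.prems(2) by (simp add: e'_def act_mult[symmetric] power_Suc2 del: power_Suc)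
    moreover have "e' \<in> V"
      unfolding e'_def act_diff_left of_int
      using assms(2) Suc.prems(1) V by (intro subspace_diff subspace_scale)
    ultimately have "e' \<in> W" by (rule Suc.IH[rotated])
    then have "act (E + of_int c) e - e' \<in> W"
      using W[OF Suc.prems(1)] assms(3) by (intro subspace_diff)
    also have "act (E + of_int c) e - e' = kscale act (of_int (u + c)) e"
      unfolding of_int[symmetric] e'_def by (simp add: act_diff_left act_add_left)
    finally have "kscale act (inverse (of_int (u + c))) (kscale act (of_int (u + c)) e) \<in> W"
      by (rule subspace_scale[OF assms(3)])
    \<comment> \<open>Characteristic zero makes the nonzero integer invertible in
      \<open>K\<close>.\<close>
    moreover have "of_int (u + c) \<noteq> (0::'k)" using assms(6) by (simp only: of_int_eq_0_iff not_False_eq_True)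
    ultimately show ?case by simp
  qed
qed

section \<open>Uniform treatment of the two blocks of variables\<close>

definition block :: "bool \<Rightarrow> ('n + 'm) set" where
  "block l = (if l then range Inl else range Inr)"

definition block_degree :: "bool \<Rightarrow> int \<times> int \<Rightarrow> int" where
  "block_degree l d = (if l then fst d else snd d)"

definition euler :: "bool \<Rightarrow> ('k::field_char_0, 'n::finite + 'm::finite) weyl" where
  "euler l = (\<Sum>x\<in>block l. wvar x * wpartial x)"

lemma euler_True: "euler True = euler_X" and euler_False: "euler False = euler_Y"
  by (simp_all add: euler_def euler_X_def euler_Y_def block_def sum.reindex)

lemma card_block: "card (block l :: ('n::finite + 'm::finite) set) = (if l then CARD('n) else CARD('m))"
  by (simp add: block_def card_image)

text \<open>The bidegree of \<open>raise_op s x\<close> for \<open>x\<close> in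
  \<open>block l\<close>.\<close>

definition block_step :: "bool \<Rightarrow> bool \<Rightarrow> int \<times> int" where
  "block_step s l = (let t = (if s then 1 else - 1) in if l then (t, 0) else (0, t))"

lemma wmonom_mem_weyl_component:
  "wmonom is js \<in> weyl_component (sum_list (map var_bideg is) - sum_list (map var_bideg js))"
proof -
  interpret vector_space "kscale ((*) :: ('k::field_char_0, 'n + 'm) weyl \<Rightarrow> _)"
    by (rule vector_space_kscale[OF left_module_times])
  show ?thesis
    unfolding weyl_component_def by (rule span_base) blast
qed

lemma raise_op_mem_weyl_component: "x \<in> block l \<Longrightarrow> raise_op s x \<in> weyl_component (block_step s l)"
  using wmonom_mem_weyl_component[of "[x]" "[]"] wmonom_mem_weyl_component[of "[]" "[x]"]
  by (cases l) (auto simp: raise_op_def block_def block_step_def wmonom_def)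

locale eulerian_module = left_module act
  for act :: "('k::field_char_0, 'n::finite + 'm::finite) weyl \<Rightarrow> 'v::ab_group_add \<Rightarrow> 'v" +
  fixes M :: "int \<times> int \<Rightarrow> 'v set"
  assumes graded: "bigraded act M" and eulerian: "generalized_eulerian act M"

sublocale eulerian_module \<subseteq> vector_space "kscale act"
  by (rule vector_space_kscale[OF left_module_axioms])

context eulerian_module
begin

lemma subspace_component: "subspace (M d)"
  using graded[unfolded bigraded_def, THEN conjunct1] by (rule spec)

lemma act_raise_op_mem:
  assumes "x \<in> block l" "e \<in> M d"
  shows "act (raise_op s x) e \<in> M (d + block_step s l)"
  using graded[unfolded bigraded_def, THEN conjunct2, THEN conjunct2, rule_format,
      OF raise_op_mem_weyl_component[OF assms(1)] assms(2)]
  by (simp only: add.commute)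

text \<open>Going back with \<open>raise_op (\<not> s)\<close> and forth with
  \<open>raise_op s\<close>, summed over the block, is the Euler operator up to an added scalar. Off
  the excluded degree its only generalized eigenvalue is nonzero, so its values fill the
  component.\<close>

lemma component_eq_span:
  assumes "block_degree l d \<noteq> (if s then 0 else - int (card (block l :: ('n + 'm) set)))"
  shows "M d = span (\<Union>x\<in>block l. act (raise_op s x) ` M (d - block_step s l))"
proof
  let ?W = "span (\<Union>x\<in>block l. act (raise_op s x) ` M (d - block_step s l))"
  show "?W \<subseteq> M d"
    by (rule span_minimal[OF _ subspace_component])
      (use act_raise_op_mem[of _ l _ "d - block_step s l" s] in auto)
  show "M d \<subseteq> ?W"
  proof
    fix e assume e: "e \<in> M d"
    obtain a where a: "act ((euler l - of_int (block_degree l d)) ^ a) e = 0"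
      using eulerian[unfolded generalized_eulerian_def, rule_format, of e "fst d" "snd d"] e
      by (cases l) (auto simp: euler_True euler_False block_degree_def)
    have opposite: "block_step (\<not> s) l = - block_step s l"
      by (simp add: block_step_def Let_def)
    \<comment> \<open>Each \<open>wpartial x * wvar x\<close> equals
      \<open>wvar x * wpartial x + 1\<close>, which adds up to the size of the block when
      \<open>s\<close> is false.\<close>
    let ?c = "if s then 0 else int (card (block l :: ('n + 'm) set))"
    have shift: "euler l + of_int ?c = (\<Sum>x\<in>block l. raise_op s x * (raise_op (\<not> s) x :: ('k, 'n + 'm) weyl))"
      by (simp add: euler_def raise_op_def wpartial_wvar sum.distrib)
    have W: "act (euler l + of_int ?c) e \<in> ?W" if "e \<in> M d" for e
      unfolding shift act_sum_left
    proof (rule subspace_sum[OF subspace_span])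
      fix x :: "'n + 'm" assume x: "x \<in> block l"
      then have "act (raise_op (\<not> s) x) e \<in> M (d - block_step s l)"
        using act_raise_op_mem[OF x that, of "\<not> s"] by (simp add: opposite)
      then show "act (raise_op s x * raise_op (\<not> s) x) e \<in> ?W"
        unfolding act_mult by (intro span_base UN_I[OF x] imageI[where f = "act (raise_op s x)"])
    qed
    have V: "act (euler l) e \<in> M d" if "e \<in> M d" for e
      unfolding euler_def act_sum_left
    proof (rule subspace_sum[OF subspace_component])
      fix x :: "'n + 'm" assume x: "x \<in> block l"
      from act_raise_op_mem[OF x act_raise_op_mem[OF x that, of False], of True]
      show "act (wvar x * wpartial x) e \<in> M d"
        by (cases l) (simp_all add: raise_op_def act_mult block_step_def add.assoc zero_prod_def[symmetric])
    qed
    show "e \<in> ?W"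
      by (rule nilpotent_shift_imp_mem[OF left_module_axioms subspace_component subspace_span V W _ e a])
        (use assms in \<open>auto split: if_splits\<close>)
  qed
qed

lemma kfinite_step:
  assumes "kfinite act (M (d - block_step s l))"
    and "block_degree l d \<noteq> (if s then 0 else - int (card (block l :: ('n + 'm) set)))"
  shows "kfinite act (M d)"
proof -
  obtain B where "finite B" "M (d - block_step s l) = span B"
    using assms(1) unfolding kfinite_def by blast
  then have "M d = span (\<Union>h\<in>(\<lambda>x. act (raise_op s x)) ` block l. h ` B)"
    unfolding component_eq_span[OF assms(2)]
    using span_Union_image_span[of "(\<lambda>x. act (raise_op s x)) ` block l" B]
      module_hom_act[OF left_module_axioms] by auto
  moreover have "finite (\<Union>h\<in>(\<lambda>x. act (raise_op s x)) ` (block l :: ('n + 'm) set). h ` B)"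
    using \<open>finite B\<close> by simp
  ultimately show ?thesis unfolding kfinite_def by blast
qed

text \<open>Coordinates counted outwards from the corner, so that all four quadrants are
  parametrised by pairs of natural numbers.\<close>

definition quadrant_point :: "bool \<Rightarrow> bool \<Rightarrow> nat \<Rightarrow> nat \<Rightarrow> int \<times> int" where
  "quadrant_point s t a b =
     (if s then int a else - int CARD('n) - int a, if t then int b else - int CARD('m) - int b)"

text \<open>Outward steps never arrive at the degree excluded in \<open>component_eq_span\<close>:
  that degree belongs to the corner, and \<open>Suc\<close> keeps away from it.\<close>

lemma component_quadrant_Suc:
  "M (quadrant_point s t (Suc a) b) =
     span (\<Union>h\<in>{act (raise_op s (Inl i)) | i. True}. h ` M (quadrant_point s t a b))"
  "M (quadrant_point s t a (Suc b)) =
     span (\<Union>h\<in>{act (raise_op t (Inr j)) | j. True}. h ` M (quadrant_point s t a b))"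
proof -
  have "quadrant_point s t (Suc a) b - block_step s True = quadrant_point s t a b"
    "quadrant_point s t a (Suc b) - block_step t False = quadrant_point s t a b"
    by (simp_all add: quadrant_point_def block_step_def)
  moreover have "block_degree True (quadrant_point s t (Suc a) b) \<noteq>
      (if s then 0 else - int (card (block True :: ('n + 'm) set)))"
    "block_degree False (quadrant_point s t a (Suc b)) \<noteq>
      (if t then 0 else - int (card (block False :: ('n + 'm) set)))"
    by (simp_all add: quadrant_point_def block_degree_def card_block)
  ultimately show
    "M (quadrant_point s t (Suc a) b) =
       span (\<Union>h\<in>{act (raise_op s (Inl i)) | i. True}. h ` M (quadrant_point s t a b))"
    "M (quadrant_point s t a (Suc b)) =
       span (\<Union>h\<in>{act (raise_op t (Inr j)) | j. True}. h ` M (quadrant_point s t a b))"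
    using component_eq_span[of True "quadrant_point s t (Suc a) b" s]
      component_eq_span[of False "quadrant_point s t a (Suc b)" t]
    by (simp_all add: block_def image_image full_SetCompr_eq)
qed

text \<open>Inward steps use the opposite operators, whose excluded degree lies outside the
  quadrant.\<close>

lemma kfinite_quadrant_corner:
  assumes "kfinite act (M (quadrant_point s t a b))"
  shows "kfinite act (M (quadrant_point s t 0 0))"
proof -
  have step: "quadrant_point s t a b - block_step (\<not> s) True = quadrant_point s t (Suc a) b"
    "quadrant_point s t a b - block_step (\<not> t) False = quadrant_point s t a (Suc b)" for a b
    by (simp_all add: quadrant_point_def block_step_def)
  \<comment> \<open>Both blocks are nonempty, so degrees from \<open>0\<close> upwards never meet
    \<open>- n\<close> or \<open>- m\<close>.\<close>
  have nonzero: "int a \<noteq> - int CARD('n)" "int a \<noteq> - int CARD('m)" for a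
    using zero_less_card_finite[where 'a='n] zero_less_card_finite[where 'a='m] by linarith+
  have deg: "block_degree True (quadrant_point s t a b) \<noteq>
      (if \<not> s then 0 else - int (card (block True :: ('n + 'm) set)))"
    "block_degree False (quadrant_point s t a b) \<noteq>
      (if \<not> t then 0 else - int (card (block False :: ('n + 'm) set)))" for a b
    using nonzero by (simp_all add: quadrant_point_def block_degree_def card_block)
  have "kfinite act (M (quadrant_point s t 0 b))"
    using assms
  proof (induction a)
    case (Suc a)
    then show ?case using kfinite_step[OF _ deg(1), of a b] by (simp only: step)
  qed
  then show ?thesis
  proof (induction b)
    case (Suc b)
    then show ?case using kfinite_step[OF _ deg(2), of 0 b] by (simp only: step)
  qed
qed

lemma quadrant_dim_eventually_poly:
  "\<exists>P. (\<exists>a b. kfinite act (M (quadrant_point s t a b))) \<longrightarrow>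
     (\<exists>N. \<forall>a\<ge>N. \<forall>b\<ge>N. case_prod (dim_given_by act M P) (quadrant_point s t a b))"
proof (cases "kfinite act (M (quadrant_point s t 0 0))")
  case False
  \<comment> \<open>One finite component would make the corner finite, so the implication is
    vacuous.\<close>
  then show ?thesis using kfinite_quadrant_corner by blast
next
  case True
  then obtain B where B: "finite B" "M (quadrant_point s t 0 0) = span B"
    unfolding kfinite_def by blast
  obtain xs :: "'n list" where xs: "set xs = UNIV" using finite_list[OF finite] by blast
  obtain ys :: "'m list" where ys: "set ys = UNIV" using finite_list[OF finite] by blast
  \<comment> \<open>The labels record which degree an operator changes. One sign per block,
    \<open>s\<close> or \<open>t\<close>, makes all of them commute.\<close>
  define ops where "ops = map (\<lambda>i. (True, act (raise_op s (Inl i)))) xs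
    @ map (\<lambda>j. (False, act (raise_op t (Inr j)))) ys"
  have hom: "\<forall>p\<in>set ops. module_hom (kscale act) (kscale act) (snd p)"
    using module_hom_act[OF left_module_axioms] by (auto simp: ops_def)
  have comm: "\<forall>p\<in>set ops. \<forall>q\<in>set ops. \<forall>x. snd p (snd q x) = snd q (snd p x)"
  proof -
    have "act (raise_op s' x) (act (raise_op t' y) v) = act (raise_op t' y) (act (raise_op s' x) v)"
      if "s' = t' \<or> x \<noteq> y" for s' t' x y v
      using raise_op_commute[OF that] by (metis act_mult)
    then show ?thesis unfolding ops_def by auto
  qed
  have ops: "{h. (True, h) \<in> set ops} = {act (raise_op s (Inl i)) | i. True}"
    "{h. (False, h) \<in> set ops} = {act (raise_op t (Inr j)) | j. True}"
    by (auto simp: ops_def xs ys)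
  let ?N = "\<lambda>a b. M (quadrant_point s t a b)"
  have Suc: "?N (Suc a) b = span (\<Union>h\<in>{h. (True, h) \<in> set ops}. h ` ?N a b)"
    "?N a (Suc b) = span (\<Union>h\<in>{h. (False, h) \<in> set ops}. h ` ?N a b)" for a b
    unfolding ops by (rule component_quadrant_Suc)+
  note hilbert = eventually_poly2_dim[of ops B ?N, OF hom comm B Suc]
  have kfinite: "kfinite act (?N a b)" for a b
    unfolding kfinite_def by (rule hilbert(1))
  \<comment> \<open>The corner \<open>(c, c')\<close> and the outward directions, in the form
    required by \<open>eventually_poly2_imp_poly2\<close>.\<close>
  define c c' \<sigma> \<tau> where "c = (if s then 0 else - int CARD('n))" and "c' = (if t then 0 else - int CARD('m))"
    and "\<sigma> = (if s then 1 else - 1 :: int)" and "\<tau> = (if t then 1 else - 1 :: int)"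
  have "\<sigma> * \<sigma> = 1" "\<tau> * \<tau> = 1" by (simp_all add: \<sigma>_def \<tau>_def)
  from eventually_poly2_imp_poly2[OF hilbert(2) this, of c c']
  obtain P N where P: "\<And>a b. a \<ge> N \<Longrightarrow> b \<ge> N \<Longrightarrow>
      poly2 P (c + \<sigma> * int a) (c' + \<tau> * int b) = of_nat (dim (?N a b))"
    by blast
  have point: "quadrant_point s t a b = (c + \<sigma> * int a, c' + \<tau> * int b)" for a b
    by (simp add: quadrant_point_def c_def c'_def \<sigma>_def \<tau>_def)
  have dim: "case_prod (dim_given_by act M P) (quadrant_point s t a b)" if "a \<ge> N" "b \<ge> N" for a b
    using P[OF that] kfinite[of a b] unfolding point by (simp add: dim_given_by_def)
  show ?thesis
    by (intro exI[of _ P] impI exI[of _ N] allI) (rule dim)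
qed

lemma quadrant_dim_poly:
  "\<exists>P. (\<exists>u v. (if s then u \<ge> 0 else u \<le> - int CARD('n)) \<and> (if t then v \<ge> 0 else v \<le> - int CARD('m)) \<and>
        kfinite act (M (u, v))) \<longrightarrow>
     (\<exists>u0 v0. \<forall>u v. (if s then u \<ge> u0 else u \<le> u0) \<longrightarrow> (if t then v \<ge> v0 else v \<le> v0) \<longrightarrow>
        dim_given_by act M P u v)"
proof -
  obtain P where P: "\<exists>a b. kfinite act (M (quadrant_point s t a b)) \<Longrightarrow>
     \<exists>N. \<forall>a\<ge>N. \<forall>b\<ge>N. case_prod (dim_given_by act M P) (quadrant_point s t a b)"
    using quadrant_dim_eventually_poly by blast
  have point: "\<exists>a\<ge>N. \<exists>b\<ge>N. (u, v) = quadrant_point s t a b"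
    if "if s then u \<ge> int N else u \<le> - int CARD('n) - int N"
      "if t then v \<ge> int N else v \<le> - int CARD('m) - int N" for u v N
    using that
    by (intro exI[of _ "nat (if s then u else - int CARD('n) - u)"] conjI
        exI[of _ "nat (if t then v else - int CARD('m) - v)"])
      (auto simp: quadrant_point_def split: if_splits)
  show ?thesis
  proof (intro exI[of _ P] impI)
    assume "\<exists>u v. (if s then u \<ge> 0 else u \<le> - int CARD('n)) \<and>
      (if t then v \<ge> 0 else v \<le> - int CARD('m)) \<and> kfinite act (M (u, v))"
    then obtain u v where "if s then u \<ge> 0 else u \<le> - int CARD('n)"
      "if t then v \<ge> 0 else v \<le> - int CARD('m)" and fin: "kfinite act (M (u, v))" by blast
    \<comment> \<open>Taking \<open>N = 0\<close> in \<open>point\<close> covers the whole quadrant,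
      its corner included.\<close>
    then obtain a b where "(u, v) = quadrant_point s t a b"
      using point[of 0 u v, unfolded of_nat_0 diff_zero] by blast
    with fin have "\<exists>a b. kfinite act (M (quadrant_point s t a b))" by auto
    from P[OF this] obtain N where N: "\<forall>a\<ge>N. \<forall>b\<ge>N.
        case_prod (dim_given_by act M P) (quadrant_point s t a b)" ..
    have "dim_given_by act M P u v"
      if uv: "if s then u \<ge> int N else u \<le> - int CARD('n) - int N"
        "if t then v \<ge> int N else v \<le> - int CARD('m) - int N" for u v
    proof -
      obtain a b where ab: "a \<ge> N" "b \<ge> N" and eq: "(u, v) = quadrant_point s t a b"
        using point[OF uv] by blast
      from N[rule_format, OF ab] show ?thesis unfolding eq[symmetric] by simp
    qed
    then show "\<exists>u0 v0. \<forall>u v. (if s then u \<ge> u0 else u \<le> u0) \<longrightarrow> (if t then v \<ge> v0 else v \<le> v0) \<longrightarrow>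
        dim_given_by act M P u v"
      by (intro exI[of _ "if s then int N else - int CARD('n) - int N"]
          exI[of _ "if t then int N else - int CARD('m) - int N"]) (simp split: if_splits)
  qed
qed

end

theorem theorem6p10:
  fixes act :: "('k::field_char_0, 'n::finite + 'm::finite) weyl \<Rightarrow> 'v::ab_group_add \<Rightarrow> 'v"
    and M :: "int \<times> int \<Rightarrow> 'v set"
  assumes "left_module act"
    and "bigraded act M"
    and "holonomic act"
    and "generalized_eulerian act M"
  shows "\<exists>P1 P2 P3 P4 :: rat poly poly.
    ((\<exists>u1 v1. u1 \<ge> 0 \<and> v1 \<ge> 0 \<and> kfinite act (M (u1, v1))) \<longrightarrow>
       (\<exists>u0 v0. \<forall>u\<ge>u0. \<forall>v\<ge>v0. dim_given_by act M P1 u v)) \<and>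
    ((\<exists>u1 v1. u1 \<le> - int CARD('n) \<and> v1 \<ge> 0 \<and> kfinite act (M (u1, v1))) \<longrightarrow>
       (\<exists>u0 v0. \<forall>u\<le>u0. \<forall>v\<ge>v0. dim_given_by act M P2 u v)) \<and>
    ((\<exists>u1 v1. u1 \<le> - int CARD('n) \<and> v1 \<le> - int CARD('m) \<and> kfinite act (M (u1, v1))) \<longrightarrow>
       (\<exists>u0 v0. \<forall>u\<le>u0. \<forall>v\<le>v0. dim_given_by act M P3 u v)) \<and>
    ((\<exists>u1 v1. u1 \<ge> 0 \<and> v1 \<le> - int CARD('m) \<and> kfinite act (M (u1, v1))) \<longrightarrow>
       (\<exists>u0 v0. \<forall>u\<ge>u0. \<forall>v\<le>v0. dim_given_by act M P4 u v))"
proof -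
  have "eulerian_module act M"
    by (rule eulerian_module.intro[OF assms(1) eulerian_module_axioms.intro[OF assms(2,4)]])
  note quadrant = eulerian_module.quadrant_dim_poly[OF this]
  \<comment> \<open>The sign choices follow the order of the four claims; \<open>True\<close> stands
    for growing degree.\<close>
  from quadrant[of True True] quadrant[of False True] quadrant[of False False] quadrant[of True False]
  show ?thesis
    unfolding if_True if_False by metis
qed

end
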